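(* Let $G=(V,E)$ be the complete undirected graph with vertex set $V=\{1,2,\ldots,n\}$, $n\ge 3$, and let $w(i,j)=w(j,i)$ denote the nonnegative real weight of the edge between $i$ and $j$. This instance of the undirected shortest path problem has the constant objective value property (COVP) if and only if there exist nonnegative reals $a$ and $b$ such that for all $1\le i<j\le n$ $$w(i,j)=w(j,i)=\begin{cases} a & \text{if } i=1,\ j\neq n,\\ b & \text{if } i\neq 1,\ j=n,\\ a+b & \text{if } i=1,\ j=n,\\ 0 & \text{otherwise.}\end{cases}$$
   Context: The feasible solutions of the shortest path problem are the (simple) paths in $G$ from vertex $1$ to vertex $n$; the objective value of a path is the sum of the weights of its edges. An instance has the constant objective value property (COVP) if all feasible solutions have the same objective value. *)

theory Defs
  imports Complex_Main "Graph_Theory.Weighted_Graph" "Graph_Theory.Pair_Digraph"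
    "Graph_Theory.Kuratowski"
begin

text \<open>Graph_Theory represents an undirected simple graph (locale \<^locale>\<open>graph\<close>) as a finite
  loop-free symmetric digraph: the edge between \<open>i\<close> and \<open>j\<close> is the pair of arcs \<open>(i, j)\<close> and
  \<open>(j, i)\<close>. A simple undirected path from \<open>s\<close> to \<open>t\<close> is therefore an arc path, listed in the
  direction of travel.\<close>

definition sp_feasible :: "'a pair_pre_digraph \<Rightarrow> 'a \<Rightarrow> 'a \<Rightarrow> ('a \<times> 'a) awalk set" where
  "sp_feasible G s t = {p. pre_digraph.apath (with_proj G) s p t}"

definition sp_objective :: "('a \<Rightarrow> 'a \<Rightarrow> real) \<Rightarrow> ('a \<times> 'a) awalk \<Rightarrow> real" where
  "sp_objective w p = wf_digraph.awalk_cost (\<lambda>(i, j). w i j) p"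

definition covp :: "'s set \<Rightarrow> ('s \<Rightarrow> real) \<Rightarrow> bool" where
  "covp F f \<longleftrightarrow> (\<forall>x\<in>F. \<forall>y\<in>F. f x = f y)"

end

theory Submission
  imports Defs
begin

text \<open>Let \<open>s = 1\<close> and \<open>t = n\<close>. Compare the paths \<open>s, t\<close>; \<open>s, i, t\<close>; \<open>s, i, j, t\<close>; \<open>s, j, i, t\<close> with common value
  \<open>C\<close>. Adding the values of the last two and subtracting those of \<open>s, i, t\<close> and \<open>s, j, t\<close>
  leaves \<open>2 * w i j = 0\<close>; then \<open>w s i + w j t = C = w s i + w i t\<close> shows that \<open>w i t\<close>, and hence
  also \<open>w s i\<close>, does not depend on \<open>i\<close>.
  Conversely, a path pays \<open>a\<close> for leaving \<open>s\<close>, \<open>b\<close> for entering \<open>t\<close>, and nothing else.\<close>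

text \<open>A simple path stops at its first visit to \<open>t\<close>: it has exactly one arc into
  \<open>t\<close>, unless it is empty, and none out of \<open>t\<close>. The weight assumption
  therefore excludes arcs out of \<open>t\<close>, which in the application may also cost
  \<open>b\<close> by symmetry. The lemma serves for what remains of a path after its first
  arc.\<close>

lemma (in pair_wf_digraph) awalk_cost_avoiding_source:
  fixes w :: "'a \<Rightarrow> 'a \<Rightarrow> real"
  assumes "apath u p t" "s \<notin> set (pawalk_verts u p)"
    and w: "\<And>i j. \<lbrakk>(i, j) \<in> parcs G; i \<noteq> s; j \<noteq> s; i \<noteq> t\<rbrakk> \<Longrightarrow> w i j = (if j = t then b else 0)"
  shows "awalk_cost (\<lambda>(i, j). w i j) p = (if u = t then 0 else b)"
  using assms(1,2)
proof (induction p arbitrary: u)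
  case Nil
  then show ?case by (simp add: apath_Nil_iff)
next
  case (Cons e p)
  obtain v where e: "e = (u, v)" "(u, v) \<in> parcs G" and p: "apath v p t"
    using Cons.prems(1) by (cases e) (auto simp: apath_Cons_iff)
  have "u \<noteq> t"
    using apath_nonempty_ends[OF Cons.prems(1)] by simp
  moreover have "v \<noteq> s"
    using Cons.prems(2) hd_in_awalk_verts(2)[OF p] e by auto
  moreover have "u \<noteq> s" and IH: "awalk_cost (\<lambda>(i, j). w i j) p = (if v = t then 0 else b)"
    using Cons.IH[OF p] Cons.prems(2) e by auto
  ultimately show ?case
    using w[OF e(2)] e(1) by auto
qed

theorem theorem4p3:
  fixes n :: nat and G :: "nat pair_pre_digraph" and w :: "nat \<Rightarrow> nat \<Rightarrow> real"
  assumes n: "n \<ge> 3"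
    and complete: "complete_digraph n (with_proj G)"
    and verts: "pverts G = {1..n}"
    and sym: "\<And>i j. (i, j) \<in> parcs G \<Longrightarrow> w i j = w j i"
    and nonneg: "\<And>i j. (i, j) \<in> parcs G \<Longrightarrow> 0 \<le> w i j"
  shows "covp (sp_feasible G 1 n) (sp_objective w) \<longleftrightarrow>
    (\<exists>a b :: real. 0 \<le> a \<and> 0 \<le> b \<and>
      (\<forall>i j. 1 \<le> i \<and> i < j \<and> j \<le> n \<longrightarrow>
        w i j = w j i \<and>
        w j i = (if i = 1 \<and> j \<noteq> n then a
                 else if i \<noteq> 1 \<and> j = n then b
                 else if i = 1 \<and> j = n then a + b
                 else 0)))"
    (is "?covp \<longleftrightarrow> (\<exists>a b. 0 \<le> a \<and> 0 \<le> b \<and> ?weights a b)")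
proof -
  have arcs: "(i, j) \<in> parcs G \<longleftrightarrow> i \<in> {1..n} \<and> j \<in> {1..n} \<and> i \<noteq> j" for i j
    using complete verts by (auto simp: complete_digraph_pair_def)
  interpret pair_wf_digraph G
    using arcs verts by unfold_locales auto
  show ?thesis
  proof
    assume ?covp
    then have covp: "awalk_cost (\<lambda>(i, j). w i j) p = awalk_cost (\<lambda>(i, j). w i j) q"
      if "apath 1 p n" "apath 1 q n" for p q
      using that unfolding covp_def sp_feasible_def sp_objective_def by blast
    have direct: "apath 1 [(1, n)] n"
      using n by (auto simp: apath_simps arcs verts)
    have two: "w 1 i + w i n = w 1 n" if "i \<in> {1<..<n}" for i
    proof -
      have "apath 1 [(1, i), (i, n)] n"
        using n that by (auto simp: apath_simps arcs verts)
      from covp[OF this direct] show ?thesis by simp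
    qed
    have three: "w 1 i + w i j + w j n = w 1 n"
      if "i \<in> {1<..<n}" "j \<in> {1<..<n}" "i \<noteq> j" for i j
    proof -
      have "apath 1 [(1, i), (i, j), (j, n)] n"
        using n that by (auto simp: apath_simps arcs verts)
      from covp[OF this direct] show ?thesis by simp
    qed
    have w_sym: "w i j = w j i" if "i \<in> {1..n}" "j \<in> {1..n}" for i j
      using sym[of i j] that arcs by (cases "i = j") auto
    have inner: "w i j = 0" if "i \<in> {1<..<n}" "j \<in> {1<..<n}" "i \<noteq> j" for i j
      using three[of i j] three[of j i] two[of i] two[of j] w_sym[of i j] that by auto
    have const: "w 1 i = w 1 2" "w i n = w 2 n" if "i \<in> {1<..<n}" for i
    proof -
      \<comment> \<open>Since \<open>n \<ge> 3\<close>, the vertex 2 is inner and can serve as the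
        reference vertex; its edges to 1 and \<open>n\<close> supply the witnesses for
        \<open>a\<close> and \<open>b\<close>.\<close>
      have 2: "2 \<in> {1<..<n}" using n by simp
      show "w i n = w 2 n"
        using three[of 2 i] inner[of 2 i] two[of 2] 2 that by (cases "i = 2") auto
      then show "w 1 i = w 1 2"
        using two[OF that] two[OF 2] by simp
    qed
    have "0 \<le> w 1 2" "0 \<le> w 2 n"
      using n by (auto intro!: nonneg simp: arcs)
    moreover have "?weights (w 1 2) (w 2 n)"
    proof (intro allI impI)
      fix i j
      assume ij: "1 \<le> i \<and> i < j \<and> j \<le> n"
      then have "w i j = w j i" by (intro w_sym) auto
      \<comment> \<open>The four cases follow in order from \<open>const(1)\<close>,
        \<open>const(2)\<close>, the detour through 2 and \<open>inner\<close>.\<close>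
      moreover have "w i j = (if i = 1 \<and> j \<noteq> n then w 1 2 else if i \<noteq> 1 \<and> j = n then w 2 n
          else if i = 1 \<and> j = n then w 1 2 + w 2 n else 0)"
        using ij n const(1)[of j] const(2)[of i] inner[of i j] two[of 2] by auto
      ultimately show "w i j = w j i \<and> w j i = (if i = 1 \<and> j \<noteq> n then w 1 2
          else if i \<noteq> 1 \<and> j = n then w 2 n else if i = 1 \<and> j = n then w 1 2 + w 2 n else 0)"
        by simp
    qed
    ultimately show "\<exists>a b. 0 \<le> a \<and> 0 \<le> b \<and> ?weights a b" by blast
  next
    assume "\<exists>a b. 0 \<le> a \<and> 0 \<le> b \<and> ?weights a b"
    then obtain a b where weights: "?weights a b" by blast
    have from_source: "w 1 j = (if j = n then a + b else a)" if "(1, j) \<in> parcs G" for j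
      using weights[rule_format, of 1 j] that by (auto simp: arcs)
    have off_source: "w i j = (if j = n then b else 0)"
      if "(i, j) \<in> parcs G" "i \<noteq> 1" "j \<noteq> 1" "i \<noteq> n" for i j
    proof (cases "i < j")
      case True
      then show ?thesis using weights[rule_format, of i j] that by (auto simp: arcs)
    next
      \<comment> \<open>An edge may be traversed downwards, while \<open>weights\<close> lists only
        increasing pairs. Here 1 < j < i < n, so both ends are inner and the weight is 0.\<close>
      case False
      then have "j < i" using that by (auto simp: arcs)
      then show ?thesis using weights[rule_format, of j i] that by (auto simp: arcs)
    qed
    have "awalk_cost (\<lambda>(i, j). w i j) p = a + b" if p: "apath 1 p n" for p
    proof (cases p)
      case Nil
      then show ?thesis using p n by (simp add: apath_Nil_iff)
    next
      case (Cons e q)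
      then obtain v where e: "e = (1, v)" "(1, v) \<in> parcs G" and q: "apath v q n"
        and avoid: "1 \<notin> set (pawalk_verts v q)"
        using p by (cases e) (auto simp: apath_Cons_iff)
      \<comment> \<open>If \<open>v = n\<close>, the first arc already costs \<open>a + b\<close>
        and the rest is free; otherwise it costs \<open>a\<close> and the rest costs
        \<open>b\<close>.\<close>
      show ?thesis
        using awalk_cost_avoiding_source[where w = w and b = b, OF q avoid off_source]
          from_source[OF e(2)] Cons e(1) by simp
    qed
    then show ?covp
      by (auto simp: covp_def sp_feasible_def sp_objective_def)
  qed
qed

end
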